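(* For all natural numbers $n$ and $k$ with $n \ge k \ge 1$, $$\sum_{i=0}^{n-k} q^{k(n-k-i)} \genfrac{[}{]}{0pt}{}{k-1+i}{k-1}_q = \genfrac{[}{]}{0pt}{}{n}{k}_q .$$
   Context: Here $q$ is an indeterminate. For non-negative integers $n, k$, the Gaussian polynomial ($q$-binomial coefficient) is $$\genfrac{[}{]}{0pt}{}{n}{k}_q = \frac{(q^n-1)(q^{n-1}-1)\cdots(q^{n-k+1}-1)}{(q^k-1)(q^{k-1}-1)\cdots(q-1)},$$ with the empty product (case $k=0$) equal to $1$, so $\genfrac{[}{]}{0pt}{}{n}{0}_q=\genfrac{[}{]}{0pt}{}{n}{n}_q=1$. The identity is an identity of polynomials in $q$. *)

theory Defs
  imports "HOL-Computational_Algebra.Polynomial"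
begin

abbreviation qvar :: "int poly" where
  "qvar \<equiv> [:0, 1:]"

definition gauss_num :: "nat \<Rightarrow> nat \<Rightarrow> int poly" where
  "gauss_num n k = (\<Prod>i<k. qvar ^ (n - i) - 1)"

definition gauss_den :: "nat \<Rightarrow> int poly" where
  "gauss_den k = (\<Prod>i=1..k. qvar ^ i - 1)"

text \<open>
  The division below is exact; see \<open>gauss_poly_mult_den\<close>. If \<open>n < k\<close>, the numerator
  contains the factor \<open>qvar ^ 0 - 1 = 0\<close> (at \<open>i = n\<close>), so truncated subtraction in the
  later exponents is harmless.
\<close>

definition gauss_poly :: "nat \<Rightarrow> nat \<Rightarrow> int poly" where
  "gauss_poly n k = gauss_num n k div gauss_den k"

lemma qvar_power_minus_one_nonzero: "i > 0 \<Longrightarrow> qvar ^ i - 1 \<noteq> 0"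
proof
  assume "i > 0" "qvar ^ i - 1 = 0"
  then have "poly (qvar ^ i - 1) 0 = 0" by simp
  with \<open>i > 0\<close> show False by (simp add: poly_power zero_power)
qed

lemma gauss_den_nonzero: "gauss_den k \<noteq> 0"
proof -
  have "\<forall>i\<in>{1..k}. qvar ^ i - 1 \<noteq> 0"
    by (intro ballI qvar_power_minus_one_nonzero) simp
  then show ?thesis
    unfolding gauss_den_def by (subst prod_zero_iff) blast+
qed

lemma gauss_num_eq_0: "n < k \<Longrightarrow> gauss_num n k = 0"
  unfolding gauss_num_def by (auto intro!: bexI[of _ n])

lemma gauss_den_dvd_gauss_num: "gauss_den k dvd gauss_num n k"
proof (induction n arbitrary: k)
  case 0
  show ?case by (cases k) (simp_all add: gauss_num_eq_0, simp add: gauss_num_def gauss_den_def)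
next
  case (Suc n)
  show ?case
  proof (cases k)
    case 0
    then show ?thesis by (simp add: gauss_den_def)
  next
    case k: (Suc j)
    show ?thesis
    proof (cases "j \<le> n")
      case False
      then show ?thesis by (simp add: k gauss_num_eq_0)
    next
      case True
      have shift: "gauss_num (Suc n) (Suc j) = (qvar ^ Suc n - 1) * gauss_num n j"
        unfolding gauss_num_def by (subst prod.lessThan_Suc_shift) simp
      have last: "gauss_num n (Suc j) = gauss_num n j * (qvar ^ (n - j) - 1)"
        unfolding gauss_num_def by simp
      have den: "gauss_den (Suc j) = gauss_den j * (qvar ^ Suc j - 1)"
        unfolding gauss_den_def by simp
      have "Suc n = (n - j) + Suc j" using True by simp
      then have "qvar ^ Suc n = qvar ^ (n - j) * qvar ^ Suc j"
        by (metis power_add)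
      then have "gauss_num (Suc n) (Suc j)
          = gauss_num n (Suc j) + qvar ^ (n - j) * (gauss_num n j * (qvar ^ Suc j - 1))"
        unfolding shift last by (simp only: algebra_simps)
      moreover have "gauss_den (Suc j) dvd gauss_num n j * (qvar ^ Suc j - 1)"
        unfolding den by (intro mult_dvd_mono Suc.IH dvd_refl)
      ultimately show ?thesis
        unfolding k by (metis Suc.IH dvd_add dvd_mult)
    qed
  qed
qed

lemma gauss_poly_mult_den: "gauss_poly n k * gauss_den k = gauss_num n k"
  unfolding gauss_poly_def by (rule dvd_div_mult_self[OF gauss_den_dvd_gauss_num])

end

theory Submission
  imports Defs
begin

text \<open>
  Gaussian polynomials satisfy the \<open>q\<close>-Pascal rule
  \<open>[n+1, k+1] = q^(k+1) [n, k+1] + [n, k]\<close>. Applying it again and again to the first summand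
  on the right lowers the top index by one each time and collects one further factor
  \<open>q^(k+1)\<close>, until the top index drops below \<open>k + 1\<close> and that summand vanishes. What is
  left are the terms \<open>[n, k]\<close> of the successive steps, weighted by powers of \<open>q^(k+1)\<close>: a
  \<open>q\<close>-analogue of the hockey-stick identity. The proof runs this unrolling as an induction on
  the difference of the two indices.

  The rule itself (\<open>gauss_poly_Pascal\<close>) is checked after multiplication by the nonzero
  denominator of \<open>[n+1, k+1]\<close>, where it reduces to
  \<open>q^(n+1) - 1 = q^(k+1) (q^(n-k) - 1) + (q^(k+1) - 1)\<close>.
\<close>

lemma gauss_poly_eq_0: "n < k \<Longrightarrow> gauss_poly n k = 0"
  by (simp add: gauss_poly_def gauss_num_eq_0)

lemma gauss_den_Suc: "gauss_den (Suc k) = gauss_den k * (qvar ^ Suc k - 1)"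
  by (simp add: gauss_den_def)

lemma gauss_num_Suc: "gauss_num n (Suc k) = gauss_num n k * (qvar ^ (n - k) - 1)"
  by (simp add: gauss_num_def)

lemma gauss_num_Suc_Suc: "gauss_num (Suc n) (Suc k) = (qvar ^ Suc n - 1) * gauss_num n k"
  unfolding gauss_num_def by (subst prod.lessThan_Suc_shift) simp

lemma gauss_num_Pascal:
  "gauss_num (Suc n) (Suc k)
     = qvar ^ Suc k * gauss_num n (Suc k) + gauss_num n k * (qvar ^ Suc k - 1)"
proof (cases "k \<le> n")
  case True
  then have "Suc n = Suc k + (n - k)" by simp
  then have "qvar ^ Suc n = qvar ^ Suc k * qvar ^ (n - k)"
    by (metis power_add)
  then show ?thesis
    unfolding gauss_num_Suc_Suc gauss_num_Suc[of n k] by (simp only: algebra_simps mult_1_left)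
next
  case False
  then show ?thesis by (simp add: gauss_num_eq_0)
qed

lemma gauss_poly_Pascal:
  "gauss_poly (Suc n) (Suc k) = qvar ^ Suc k * gauss_poly n (Suc k) + gauss_poly n k"
proof -
  have "gauss_poly (Suc n) (Suc k) * gauss_den (Suc k)
      = qvar ^ Suc k * (gauss_poly n (Suc k) * gauss_den (Suc k))
        + gauss_poly n k * gauss_den k * (qvar ^ Suc k - 1)"
    unfolding gauss_poly_mult_den by (rule gauss_num_Pascal)
  also have "\<dots> = (qvar ^ Suc k * gauss_poly n (Suc k) + gauss_poly n k) * gauss_den (Suc k)"
    unfolding gauss_den_Suc by (simp only: distrib_right mult.assoc)
  finally show ?thesis
    using gauss_den_nonzero mult_right_cancel by blast
qed

text \<open>
  Writing the indices as \<open>k + m\<close> and \<open>k\<close> removes all truncated subtractions from the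
  Gaussian polynomials. Raising \<open>m\<close> by one multiplies every old summand by \<open>q^(k+1)\<close> and
  adds a new one with weight \<open>1\<close>, which is what the \<open>q\<close>-Pascal rule does to the right-hand side.
\<close>

lemma gauss_poly_hockey_stick:
  "(\<Sum>i=0..m. qvar ^ (Suc k * (m - i)) * gauss_poly (k + i) k) = gauss_poly (Suc (k + m)) (Suc k)"
proof (induction m)
  case 0
  show ?case by (simp add: gauss_poly_Pascal gauss_poly_eq_0)
next
  case (Suc m)
  have weight: "qvar ^ (Suc k * (Suc m - i)) = qvar ^ Suc k * qvar ^ (Suc k * (m - i))"
    if "i \<le> m" for i
    using that by (simp only: Suc_diff_le mult_Suc_right power_add)
  have "(\<Sum>i=0..Suc m. qvar ^ (Suc k * (Suc m - i)) * gauss_poly (k + i) k)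
      = (\<Sum>i=0..m. qvar ^ (Suc k * (Suc m - i)) * gauss_poly (k + i) k) + gauss_poly (k + Suc m) k"
    by (simp del: mult_Suc)
  also have "(\<Sum>i=0..m. qvar ^ (Suc k * (Suc m - i)) * gauss_poly (k + i) k)
      = qvar ^ Suc k * (\<Sum>i=0..m. qvar ^ (Suc k * (m - i)) * gauss_poly (k + i) k)"
    unfolding sum_distrib_left by (rule sum.cong) (simp_all only: weight mult.assoc atLeastAtMost_iff)
  also have "\<dots> = qvar ^ Suc k * gauss_poly (k + Suc m) (Suc k)"
    by (simp only: Suc.IH add_Suc_right)
  finally show ?case
    by (simp only: gauss_poly_Pascal)
qed

theorem theorem2:
  fixes n k :: nat
  assumes "1 \<le> k" and "k \<le> n"
  shows "(\<Sum>i=0..n-k. qvar ^ (k * (n - k - i)) * gauss_poly (k - 1 + i) (k - 1)) = gauss_poly n k"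
proof -
  obtain j where k: "k = Suc j" using assms(1) by (cases k) auto
  have "Suc (j + (n - k)) = n" using assms(2) k by simp
  then show ?thesis
    using gauss_poly_hockey_stick[of j "n - k"] by (simp only: k diff_Suc_1)
qed

end
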